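(* For every integer $n\ge 1$, the complete graph $K_n$ on $[n]$ is Cohen--Macaulay, i.e. its edge ideal $I(K_n)\subseteq R_n$ is a Cohen--Macaulay ideal.
   Context: Let $k$ be a field, $R_n=k[x_1,\dots,x_n]$ and $[n]=\{1,\dots,n\}$. The edge ideal of a simple graph $G$ on $[n]$ is $I(G)=(x_ix_j : \{i,j\}\in E(G))\subseteq R_n$. An ideal $I\subseteq R_n$ is called Cohen--Macaulay if the (graded) quotient ring $R_n/I$ is Cohen--Macaulay, i.e. $\operatorname{depth}(R_n/I)=\dim(R_n/I)$. *)

theory Defs
  imports "HOL-Algebra.QuotRing" "HOL-Library.Poly_Mapping" "HOL-Library.Extended_Nat"
begin

section \<open>Krull dimension, regular sequences and depth\<close>

definition prime_chain :: "('a, 'b) ring_scheme \<Rightarrow> (nat \<Rightarrow> 'a set) \<Rightarrow> nat \<Rightarrow> bool" where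
  "prime_chain A P r \<longleftrightarrow> (\<forall>i\<le>r. primeideal (P i) A) \<and> (\<forall>i<r. P i \<subset> P (Suc i))"

definition krull_dim :: "('a, 'b) ring_scheme \<Rightarrow> enat" where
  "krull_dim A = Sup {enat r | r. \<exists>P. prime_chain A P r}"

definition nonzerodivisor :: "('a, 'b) ring_scheme \<Rightarrow> 'a \<Rightarrow> bool" where
  "nonzerodivisor A a \<longleftrightarrow>
     a \<in> carrier A \<and> (\<forall>b\<in>carrier A. a \<otimes>\<^bsub>A\<^esub> b = \<zero>\<^bsub>A\<^esub> \<longrightarrow> b = \<zero>\<^bsub>A\<^esub>)"

definition regular_sequence :: "('a, 'b) ring_scheme \<Rightarrow> 'a list \<Rightarrow> bool" where
  "regular_sequence A as \<longleftrightarrow>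
     set as \<subseteq> carrier A \<and>
     (\<forall>i<length as.
        let J = Idl\<^bsub>A\<^esub> (set (take i as)) in nonzerodivisor (A Quot J) (J +>\<^bsub>A\<^esub> (as ! i))) \<and>
     Idl\<^bsub>A\<^esub> (set as) \<noteq> carrier A"

definition depth :: "('a, 'b) ring_scheme \<Rightarrow> 'a set \<Rightarrow> enat" where
  "depth A \<mm> = Sup {enat (length as) | as. set as \<subseteq> \<mm> \<and> regular_sequence A as}"


section \<open>The polynomial ring in the variables \<open>x\<^sub>1, \<dots>, x\<^sub>n\<close>\<close>

text \<open>
  A polynomial is a finitely supported map from exponent vectors to coefficients.  The type
  has variables \<open>x\<^sub>i\<close> for all natural numbers \<open>i\<close>; the carrier keeps those polynomials
  that involve only variables with index in \<open>{1..n}\<close>.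
\<close>

type_synonym 'k mpoly = "(nat \<Rightarrow>\<^sub>0 nat) \<Rightarrow>\<^sub>0 'k"

definition poly_ring :: "nat \<Rightarrow> ('k::field) mpoly ring" where
  "poly_ring n =
     \<lparr>carrier = {p. \<forall>m\<in>Poly_Mapping.keys p. Poly_Mapping.keys m \<subseteq> {1..n}},
      mult = (*), one = 1, zero = 0, add = (+)\<rparr>"

definition var :: "nat \<Rightarrow> ('k::field) mpoly" where
  "var i = Poly_Mapping.single (Poly_Mapping.single i 1) 1"

definition irrelevant_ideal :: "nat \<Rightarrow> ('k::field) mpoly set" where
  "irrelevant_ideal n = Idl\<^bsub>poly_ring n\<^esub> (var ` {1..n})"

text \<open>
  The depth of the graded ring \<open>R\<^sub>n/I\<close> is taken with respect to its irrelevant maximal ideal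
  \<open>(x\<^sub>1, \<dots>, x\<^sub>n)/I\<close>.  The definition is meant for homogeneous \<open>I\<close>.
\<close>

definition cohen_macaulay_ideal :: "nat \<Rightarrow> ('k::field) mpoly set \<Rightarrow> bool" where
  "cohen_macaulay_ideal n I \<longleftrightarrow>
     ideal I (poly_ring n) \<and>
     depth (poly_ring n Quot I) ((\<lambda>f. I +>\<^bsub>poly_ring n\<^esub> f) ` irrelevant_ideal n)
       = krull_dim (poly_ring n Quot I)"


section \<open>Edge ideals of simple graphs on \<open>{1..n}\<close>\<close>

text \<open>A simple graph on \<open>{1..n}\<close> is given by its set of edges.\<close>

definition simple_graph :: "nat \<Rightarrow> nat set set \<Rightarrow> bool" where
  "simple_graph n E \<longleftrightarrow> (\<forall>e\<in>E. e \<subseteq> {1..n} \<and> card e = 2)"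

definition complete_graph :: "nat \<Rightarrow> nat set set" where
  "complete_graph n = {e. e \<subseteq> {1..n} \<and> card e = 2}"

definition edge_ideal :: "nat \<Rightarrow> nat set set \<Rightarrow> ('k::field) mpoly set" where
  "edge_ideal n E = Idl\<^bsub>poly_ring n\<^esub> {var i * var j | i j. {i, j} \<in> E}"


section \<open>Basic facts\<close>

lemma simple_graph_complete_graph: "simple_graph n (complete_graph n)"
  by (simp add: simple_graph_def complete_graph_def)

lemma poly_ring_mult_closed:
  assumes "p \<in> carrier (poly_ring n)" "q \<in> carrier (poly_ring n)"
  shows "p * q \<in> carrier (poly_ring n)"
proof -
  have "Poly_Mapping.keys m \<subseteq> {1..n}" if m: "m \<in> Poly_Mapping.keys (p * q)" for m
  proof -
    obtain a b where "m = a + b" "a \<in> Poly_Mapping.keys p" "b \<in> Poly_Mapping.keys q"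
      using m Poly_Mapping.keys_mult[of p q] by blast
    then show ?thesis
      using assms Poly_Mapping.keys_add[of a b] by (fastforce simp: poly_ring_def)
  qed
  then show ?thesis by (simp add: poly_ring_def)
qed

lemma poly_ring_add_closed:
  assumes "p \<in> carrier (poly_ring n)" "q \<in> carrier (poly_ring n)"
  shows "p + q \<in> carrier (poly_ring n)"
  using assms Poly_Mapping.keys_add[of p q] by (fastforce simp: poly_ring_def)

lemma cring_poly_ring: "cring (poly_ring n :: ('k::field) mpoly ring)"
proof (rule cringI)
  let ?R = "poly_ring n :: 'k mpoly ring"
  show "abelian_group ?R"
  proof (rule abelian_groupI)
    fix p assume "p \<in> carrier ?R"
    then have "- p \<in> carrier ?R" by (simp add: poly_ring_def)
    then show "\<exists>y\<in>carrier ?R. y \<oplus>\<^bsub>?R\<^esub> p = \<zero>\<^bsub>?R\<^esub>"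
      by (rule bexI[rotated]) (simp add: poly_ring_def)
  next
    fix p q assume "p \<in> carrier ?R" "q \<in> carrier ?R"
    then show "p \<oplus>\<^bsub>?R\<^esub> q \<in> carrier ?R"
      using poly_ring_add_closed[of p n q] by (simp add: poly_ring_def)
  qed (auto simp: poly_ring_def algebra_simps)
  show "comm_monoid ?R"
  proof (rule comm_monoidI)
    fix p q assume "p \<in> carrier ?R" "q \<in> carrier ?R"
    then show "p \<otimes>\<^bsub>?R\<^esub> q \<in> carrier ?R"
      using poly_ring_mult_closed[of p n q] by (simp add: poly_ring_def)
  qed (auto simp: poly_ring_def algebra_simps)
qed (auto simp: poly_ring_def algebra_simps)

lemma var_in_poly_ring: "i \<in> {1..n} \<Longrightarrow> var i \<in> carrier (poly_ring n)"
  by (simp add: var_def poly_ring_def)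

end

theory Submission
  imports Defs "HOL-Computational_Algebra.Polynomial"
begin

text \<open>
  The ideal of all \<open>x\<^sub>i x\<^sub>j\<close> with \<open>i \<noteq> j\<close> cuts out the union of the \<open>n\<close> coordinate axes in affine space: a
  reduced curve, all of whose components pass through the origin.  Both dimension and depth of its
  coordinate ring are \<open>1\<close>.

  The proof is carried by restriction to the axes.  Sending \<open>x\<^sub>i\<close> to \<open>t\<close> and the other variables to \<open>0\<close>
  gives a homomorphism to the principal ideal domain \<open>k[t]\<close>, and the edge ideal is the intersection of
  the kernels of these \<open>n\<close> homomorphisms (\<open>edge_ideal_complete_mem_iff\<close>).  Hence the quotient embeds
  into a product of \<open>n\<close> copies of \<open>k[t]\<close>, and its image consists of the tuples with a common constant term.

  A prime ideal that contains the edge ideal contains the kernel of one restriction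
  (\<open>primeideal_contains_axis_kernel\<close>), so chains of primes live in \<open>k[t]\<close>, where nonzero primes are
  maximal; this bounds the dimension.  A chain of length \<open>1\<close> is formed by the kernel of a restriction and the
  ideal of the origin.

  For the depth, the sum of the variables is regular because it restricts to \<open>t\<close> everywhere.  A second
  regular element does not exist: given \<open>f\<close> regular and \<open>g\<close>, both vanishing at the origin, an explicit
  element outside \<open>(f)\<close> is multiplied into \<open>(f)\<close> by \<open>g\<close> (\<open>second_element_not_regular\<close>).
\<close>

section \<open>Regular elements and prime chains in quotient rings\<close>

lemma (in ideal) mem_iff_rcos: "a \<in> carrier R \<Longrightarrow> a \<in> I \<longleftrightarrow> I +> a = I"
  using a_rcos_const a_rcos_self by blast

lemma (in ideal) quot_carrier: "carrier (R Quot I) = (+>) I ` carrier R"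
  by (auto simp: FactRing_def A_RCOSETS_def')

lemma (in ideal) quot_zero: "\<zero>\<^bsub>R Quot I\<^esub> = I"
  and quot_one: "\<one>\<^bsub>R Quot I\<^esub> = I +> \<one>"
  by (simp_all add: FactRing_def)

lemma (in ideal) quot_mult:
  assumes "x \<in> carrier R" "y \<in> carrier R"
  shows "(I +> x) \<otimes>\<^bsub>R Quot I\<^esub> (I +> y) = I +> (x \<otimes> y)"
  using rcoset_mult_add[OF assms] by (simp add: FactRing_def)

lemma (in ideal) nonzerodivisor_quot_iff:
  assumes "a \<in> carrier R"
  shows "nonzerodivisor (R Quot I) (I +> a) \<longleftrightarrow> (\<forall>b\<in>carrier R. a \<otimes> b \<in> I \<longrightarrow> b \<in> I)"
  using assms by (auto simp: nonzerodivisor_def quot_carrier quot_zero quot_mult mem_iff_rcos)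

lemma (in ring) genideal_empty: "Idl {} = {\<zero>}"
  using genideal_minimal[OF zeroideal, of "{}"] additive_subgroup.zero_closed[OF ideal.axioms(1)[OF genideal_ideal[of "{}"]]]
  by auto

lemma (in cring) cgenideal_altdef: "PIdl a = {a \<otimes> x | x. x \<in> carrier R}" if "a \<in> carrier R"
  unfolding cgenideal_def using that m_comm by blast

lemma (in cring) regular_sequence_singleton:
  assumes "a \<in> carrier R" "\<And>b. b \<in> carrier R \<Longrightarrow> a \<otimes> b = \<zero> \<Longrightarrow> b = \<zero>"
    and "\<And>b. b \<in> carrier R \<Longrightarrow> a \<otimes> b \<noteq> \<one>"
  shows "regular_sequence R [a]"
proof -
  have "\<one> \<notin> PIdl a" using assms(3) unfolding cgenideal_altdef[OF assms(1)] by (smt (verit) mem_Collect_eq)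
  then show ?thesis using assms(1,2)
    by (auto simp: regular_sequence_def Let_def genideal_empty cgenideal_eq_genideal[symmetric]
        ideal.nonzerodivisor_quot_iff[OF zeroideal])
qed

text \<open>
  An upper bound on depth only needs the first two members of a sequence.  Regularity of the second
  one modulo the first is phrased without any quotient: the relation \<open>b h = a w\<close> forces \<open>h\<close> into \<open>(a)\<close>.
\<close>
lemma (in cring) regular_sequence_first_two:
  assumes "regular_sequence R as" "2 \<le> length as"
  shows "\<exists>a\<in>set as. \<exists>b\<in>set as. (\<forall>h\<in>carrier R. a \<otimes> h = \<zero> \<longrightarrow> h = \<zero>) \<and>
           (\<forall>h\<in>carrier R. \<forall>w\<in>carrier R. b \<otimes> h = a \<otimes> w \<longrightarrow> (\<exists>s\<in>carrier R. h = a \<otimes> s))"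
proof -
  obtain a b cs where as: "as = a # b # cs"
    using assms(2) by (metis Suc_le_length_iff numeral_2_eq_2)
  have ab: "a \<in> carrier R" "b \<in> carrier R"
    using assms(1) by (auto simp: as regular_sequence_def)
  have reg: "i < length as \<Longrightarrow>
      nonzerodivisor (R Quot Idl (set (take i as))) (Idl (set (take i as)) +> as ! i)" for i
    using assms(1) by (auto simp: regular_sequence_def Let_def)
  have 1: "h = \<zero>" if "h \<in> carrier R" "a \<otimes> h = \<zero>" for h
    using reg[of 0] that ab(1)
    by (auto simp: as genideal_empty ideal.nonzerodivisor_quot_iff[OF zeroideal])
  have 2: "\<exists>s\<in>carrier R. h = a \<otimes> s" if "h \<in> carrier R" "w \<in> carrier R" "b \<otimes> h = a \<otimes> w" for h w
  proof -
    have "\<forall>h\<in>carrier R. b \<otimes> h \<in> PIdl a \<longrightarrow> h \<in> PIdl a"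
      using reg[of 1] ab
      by (simp add: as cgenideal_eq_genideal[symmetric]
          ideal.nonzerodivisor_quot_iff[OF cgenideal_ideal])
    with that ab show ?thesis by (auto simp: cgenideal_altdef)
  qed
  from 1 2 show ?thesis by (intro bexI[of _ a] bexI[of _ b]) (auto simp: as)
qed

text \<open>
  Because \<open>P\<close> contains \<open>I\<close>, it is a union of cosets of \<open>I\<close>.
\<close>
lemma (in cring) rcos_image_mem_iff:
  assumes "ideal I R" "ideal P R" "I \<subseteq> P" "a \<in> carrier R"
  shows "I +> a \<in> (+>) I ` P \<longleftrightarrow> a \<in> P"
proof
  assume "I +> a \<in> (+>) I ` P"
  then obtain p where "p \<in> P" "I +> a = I +> p" by auto
  then have "a \<in> I +> p"
    using assms ideal.axioms(1)[OF assms(1)]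
    by (metis abelian_subgroup.a_rcos_self abelian_subgroupI3 is_abelian_group)
  then obtain i where "i \<in> I" "a = i \<oplus> p" by (auto simp: a_r_coset_def')
  then show "a \<in> P" using \<open>p \<in> P\<close> assms
    by (auto intro: additive_subgroup.a_closed ideal.axioms(1))
qed auto

lemma (in cring) primeideal_rcos_image:
  assumes I: "ideal I R" and P: "primeideal P R" and "I \<subseteq> P"
  shows "primeideal ((+>) I ` P) (R Quot I)"
proof -
  interpret I: ideal I R by fact
  interpret P: primeideal P R by fact
  note mem = rcos_image_mem_iff[OF I P.is_ideal \<open>I \<subseteq> P\<close>]
  show ?thesis
  proof (rule primeidealI)
    show "ideal ((+>) I ` P) (R Quot I)"
      by (rule ring_ideal_imp_quot_ideal[OF I P.is_ideal])
    show "cring (R Quot I)" by (rule I.quotient_is_cring[OF is_cring])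
    show "carrier (R Quot I) \<noteq> (+>) I ` P"
    proof
      assume "carrier (R Quot I) = (+>) I ` P"
      then have "I +> \<one> \<in> (+>) I ` P" by (auto simp: I.quot_carrier)
      then show False using mem[of \<one>] P.one_imp_carrier P.I_notcarr by auto
    qed
    fix A B assume "A \<in> carrier (R Quot I)" "B \<in> carrier (R Quot I)"
      and AB: "A \<otimes>\<^bsub>R Quot I\<^esub> B \<in> (+>) I ` P"
    then obtain a b where "a \<in> carrier R" "b \<in> carrier R" "A = I +> a" "B = I +> b"
      by (auto simp: I.quot_carrier)
    with AB show "A \<in> (+>) I ` P \<or> B \<in> (+>) I ` P"
      using mem P.I_prime by (metis I.quot_mult m_closed)
  qed
qed

lemma (in cring) primeideal_rcos_vimage:
  assumes I: "ideal I R" and Q: "primeideal Q (R Quot I)"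
  shows "primeideal {a \<in> carrier R. I +> a \<in> Q} R"
proof -
  interpret I: ideal I R by fact
  interpret Q: primeideal Q "R Quot I" by fact
  show ?thesis
  proof (rule primeidealI)
    show "ideal {a \<in> carrier R. I +> a \<in> Q} R"
      by (rule ring_hom_ring.ideal_vimage[OF I.rcos_ring_hom_ring Q.is_ideal])
    show "carrier R \<noteq> {a \<in> carrier R. I +> a \<in> Q}"
    proof
      assume "carrier R = {a \<in> carrier R. I +> a \<in> Q}"
      then have "I +> \<one> \<in> Q" by blast
      then show False using Q.one_imp_carrier Q.I_notcarr by (simp add: I.quot_one)
    qed
    fix a b assume "a \<in> carrier R" "b \<in> carrier R" "a \<otimes> b \<in> {a \<in> carrier R. I +> a \<in> Q}"
    then show "a \<in> {a \<in> carrier R. I +> a \<in> Q} \<or> b \<in> {a \<in> carrier R. I +> a \<in> Q}"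
      using Q.I_prime[of "I +> a" "I +> b"] by (auto simp: I.quot_mult I.quot_carrier)
  qed (rule is_cring)
qed

text \<open>
  Images and preimages under the projection preserve primeness, and strictness of inclusions survives
  in both directions: upwards by surjectivity of the projection, downwards since the primes involved
  contain \<open>I\<close>.  Dimensions of quotients can therefore be computed upstairs.
\<close>
lemma (in cring) prime_chain_quot_iff:
  assumes I: "ideal I R"
  shows "(\<exists>Q. prime_chain (R Quot I) Q r) \<longleftrightarrow> (\<exists>P. prime_chain R P r \<and> (\<forall>i\<le>r. I \<subseteq> P i))"
proof
  interpret I: ideal I R by fact
  assume "\<exists>Q. prime_chain (R Quot I) Q r"
  then obtain Q where Q: "prime_chain (R Quot I) Q r" by blast
  define P where "P i = {a \<in> carrier R. I +> a \<in> Q i}" for i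
  have Qi: "primeideal (Q i) (R Quot I)" if "i \<le> r" for i
    using Q that by (simp add: prime_chain_def)
  have "P i \<subset> P (Suc i)" if "i < r" for i
  proof -
    have sub: "Q i \<subset> Q (Suc i)" using Q that by (simp add: prime_chain_def)
    then obtain A where A: "A \<in> Q (Suc i)" "A \<notin> Q i" by blast
    then have "A \<in> carrier (R Quot I)"
      using Qi[of "Suc i"] that by (meson Suc_leI ideal.Icarr primeideal.axioms(1))
    then obtain a where "a \<in> carrier R" "A = I +> a" by (auto simp: I.quot_carrier)
    with A have "a \<in> P (Suc i)" "a \<notin> P i" by (auto simp: P_def)
    moreover have "P i \<subseteq> P (Suc i)" using sub by (auto simp: P_def)
    ultimately show ?thesis by blast
  qed
  moreover have "I \<subseteq> P i" if "i \<le> r" for i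
  proof
    fix a assume a: "a \<in> I"
    have "\<zero>\<^bsub>R Quot I\<^esub> \<in> Q i"
      using Qi[OF that] by (simp add: additive_subgroup.zero_closed ideal.axioms(1) primeideal.axioms(1))
    with a show "a \<in> P i" by (simp add: P_def I.quot_zero I.a_rcos_const)
  qed
  ultimately show "\<exists>P. prime_chain R P r \<and> (\<forall>i\<le>r. I \<subseteq> P i)"
    using primeideal_rcos_vimage[OF I Qi] by (intro exI[of _ P]) (auto simp: prime_chain_def P_def)
next
  assume "\<exists>P. prime_chain R P r \<and> (\<forall>i\<le>r. I \<subseteq> P i)"
  then obtain P where P: "prime_chain R P r" "\<And>i. i \<le> r \<Longrightarrow> I \<subseteq> P i" by blast
  define Q where "Q i = (+>) I ` P i" for i
  have Pi: "primeideal (P i) R" if "i \<le> r" for i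
    using P that by (simp add: prime_chain_def)
  have "Q i \<subset> Q (Suc i)" if "i < r" for i
  proof -
    have sub: "P i \<subset> P (Suc i)" using P that by (simp add: prime_chain_def)
    then obtain a where a: "a \<in> P (Suc i)" "a \<notin> P i" by blast
    have "a \<in> carrier R" using a(1) Pi[of "Suc i"] that
      by (meson Suc_leI ideal.Icarr primeideal.axioms(1))
    with a(2) have "I +> a \<notin> Q i"
      using rcos_image_mem_iff[OF I primeideal.axioms(1)[OF Pi] P(2)] that by (simp add: Q_def)
    with a sub show ?thesis by (auto simp: Q_def)
  qed
  then show "\<exists>Q. prime_chain (R Quot I) Q r"
    using primeideal_rcos_image[OF I Pi P(2)]
    by (intro exI[of _ Q]) (auto simp: prime_chain_def Q_def)
qed

section \<open>Restriction of polynomials to a coordinate axis\<close>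

definition axis_monom :: "nat \<Rightarrow> (nat \<Rightarrow>\<^sub>0 nat) \<Rightarrow> ('k::field) poly" where
  "axis_monom i m = (if Poly_Mapping.keys m \<subseteq> {i} then monom 1 (Poly_Mapping.lookup m i) else 0)"

text \<open>
  This is the \<open>k\<close>-algebra homomorphism sending \<open>x\<^sub>i\<close> to \<open>t\<close> and all other variables to \<open>0\<close>:
  restriction of a polynomial function to the \<open>i\<close>-th coordinate axis.
\<close>
definition axis :: "nat \<Rightarrow> ('k::field) mpoly \<Rightarrow> 'k poly" where
  "axis i f = (\<Sum>m\<in>Poly_Mapping.keys f. smult (Poly_Mapping.lookup f m) (axis_monom i m))"

lemma keys_subset_singleton_iff:
  "Poly_Mapping.keys m \<subseteq> {i} \<longleftrightarrow> m = Poly_Mapping.single i (Poly_Mapping.lookup m i)"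
proof
  assume a: "Poly_Mapping.keys m \<subseteq> {i}"
  show "m = Poly_Mapping.single i (Poly_Mapping.lookup m i)"
  proof (rule poly_mapping_eqI)
    fix j
    show "Poly_Mapping.lookup m j
      = Poly_Mapping.lookup (Poly_Mapping.single i (Poly_Mapping.lookup m i)) j"
      using a by (cases "j = i") (auto simp: lookup_single in_keys_iff)
  qed
next
  assume "m = Poly_Mapping.single i (Poly_Mapping.lookup m i)"
  then have "Poly_Mapping.keys m = Poly_Mapping.keys (Poly_Mapping.single i (Poly_Mapping.lookup m i))"
    by simp
  then show "Poly_Mapping.keys m \<subseteq> {i}" by (auto split: if_splits)
qed

lemma coeff_axis_monom:
  "coeff (axis_monom i m) d = (if m = Poly_Mapping.single i d then 1 else 0)"
proof (cases "Poly_Mapping.keys m \<subseteq> {i}")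
  case True
  then have "m = Poly_Mapping.single i d \<longleftrightarrow> Poly_Mapping.lookup m i = d"
    by (metis keys_subset_singleton_iff lookup_single_eq)
  with True show ?thesis by (simp add: axis_monom_def)
next
  case False
  then show ?thesis by (auto simp: axis_monom_def split: if_splits)
qed

text \<open>
  The coefficients of the restriction are those of the powers of \<open>x\<^sub>i\<close>.  Additivity is immediate from
  this description, while multiplicativity is easier to see from the defining sum.
\<close>
lemma coeff_axis: "coeff (axis i f) d = Poly_Mapping.lookup f (Poly_Mapping.single i d)"
proof -
  have "coeff (axis i f) d = (\<Sum>m\<in>Poly_Mapping.keys f.
          if m = Poly_Mapping.single i d then Poly_Mapping.lookup f m else 0)"
    unfolding axis_def coeff_sum by (intro sum.cong) (auto simp: coeff_axis_monom)
  then show ?thesis by (simp add: in_keys_iff)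
qed

lemma axis_0 [simp]: "axis i 0 = 0"
  and axis_add [simp]: "axis i (f + g) = axis i f + axis i g"
  and axis_uminus [simp]: "axis i (- f) = - axis i f"
  and axis_diff [simp]: "axis i (f - g) = axis i f - axis i g"
  and axis_single: "axis i (Poly_Mapping.single m c) = smult c (axis_monom i m)"
  by (auto intro!: poly_eqI simp: coeff_axis lookup_add lookup_minus lookup_single
      coeff_axis_monom when_def)

lemma axis_monom_single [simp]: "axis_monom i (Poly_Mapping.single i d) = monom 1 d"
  by (auto simp: axis_monom_def)

lemma axis_1 [simp]: "axis i 1 = 1"
  by (subst single_one[symmetric], subst axis_single) (simp add: axis_monom_def)

lemma axis_sum [simp]: "axis i (sum f S) = (\<Sum>s\<in>S. axis i (f s))"
  by (induction S rule: infinite_finite_induct) auto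

lemma axis_monom_add: "axis_monom i (m + m') = axis_monom i m * axis_monom i m'"
proof -
  have "Poly_Mapping.keys (m + m') = Poly_Mapping.keys m \<union> Poly_Mapping.keys m'"
    by (auto simp: in_keys_iff lookup_add)
  then show ?thesis by (simp add: axis_monom_def mult_monom lookup_add)
qed

lemma sum_singles: "(\<Sum>m\<in>Poly_Mapping.keys f. Poly_Mapping.single m (Poly_Mapping.lookup f m)) = f"
  by (rule poly_mapping_eqI) (simp add: lookup_sum lookup_single when_def in_keys_iff)

lemma axis_mult [simp]: "axis i (f * g) = axis i f * axis i g"
proof -
  let ?s = "\<lambda>f m. Poly_Mapping.single m (Poly_Mapping.lookup f m)"
  have "f * g = (\<Sum>m\<in>Poly_Mapping.keys f. \<Sum>m'\<in>Poly_Mapping.keys g. ?s f m * ?s g m')"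
    by (subst (1 2) sum_singles[symmetric]) (simp add: sum_product)
  then have "axis i (f * g) = (\<Sum>m\<in>Poly_Mapping.keys f. \<Sum>m'\<in>Poly_Mapping.keys g.
      smult (Poly_Mapping.lookup f m) (axis_monom i m) * smult (Poly_Mapping.lookup g m') (axis_monom i m'))"
    by (simp add: mult_single axis_single axis_monom_add mult.commute)
  then show ?thesis by (simp add: axis_def sum_product)
qed

lemma axis_var: "axis i (var j) = (if j = i then monom 1 1 else 0)"
  by (auto simp: var_def axis_single axis_monom_def)

definition from_axis :: "nat \<Rightarrow> ('k::field) poly \<Rightarrow> 'k mpoly" where
  "from_axis i p = (\<Sum>d\<le>degree p. Poly_Mapping.single (Poly_Mapping.single i d) (coeff p d))"

lemma axis_from_axis: "axis i (from_axis i p) = p"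
  by (simp add: from_axis_def axis_single smult_monom poly_as_sum_of_monoms)

text \<open>
  Off its own axis the lift of \<open>p\<close> is constant.  So when \<open>p\<close> has no constant term, the lift vanishes on
  every other axis; this is what makes single components of an element available as elements of the
  quotient ring.
\<close>
lemma axis_from_axis_other:
  assumes "j \<noteq> i"
  shows "axis j (from_axis i p) = [:coeff p 0:]"
proof -
  have "smult (coeff p d) (axis_monom j (Poly_Mapping.single i d)) = (if d = 0 then [:coeff p 0:] else 0)" for d
    using assms by (auto simp: axis_monom_def monom_0)
  then show ?thesis by (simp add: from_axis_def axis_single)
qed

section \<open>Ideals of the polynomial ring\<close>

lemma poly_ring_sel [simp]:
  "f \<otimes>\<^bsub>poly_ring n\<^esub> g = f * g" "f \<oplus>\<^bsub>poly_ring n\<^esub> g = f + g"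
  "\<one>\<^bsub>poly_ring n\<^esub> = 1" "\<zero>\<^bsub>poly_ring n\<^esub> = 0"
  by (simp_all add: poly_ring_def)

lemma mem_poly_ring_iff:
  "f \<in> carrier (poly_ring n) \<longleftrightarrow> (\<forall>m\<in>Poly_Mapping.keys f. Poly_Mapping.keys m \<subseteq> {1..n})"
  by (simp add: poly_ring_def)

lemma poly_ring_uminus_closed: "f \<in> carrier (poly_ring n) \<Longrightarrow> - f \<in> carrier (poly_ring n)"
  by (simp add: mem_poly_ring_iff)

lemma poly_ring_a_minus:
  fixes f g :: "('k::field) mpoly"
  assumes "f \<in> carrier (poly_ring n)" "g \<in> carrier (poly_ring n)"
  shows "f \<ominus>\<^bsub>poly_ring n\<^esub> g = f - g"
proof -
  interpret cring "poly_ring n :: 'k mpoly ring" by (rule cring_poly_ring)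
  have "\<ominus>\<^bsub>poly_ring n\<^esub> g = - g"
    using assms(2) poly_ring_uminus_closed[OF assms(2)] by (intro minus_equality) auto
  then show ?thesis by (simp add: a_minus_def)
qed

lemma ideal_poly_ring_sum:
  assumes "ideal J (poly_ring n :: ('k::field) mpoly ring)" "\<And>s. s \<in> S \<Longrightarrow> g s \<in> J"
  shows "sum g S \<in> J"
proof -
  have "additive_subgroup J (poly_ring n)" by (rule ideal.axioms(1)) fact
  note J = additive_subgroup.zero_closed[OF this] additive_subgroup.a_closed[OF this]
  show ?thesis
    using assms(2) J
    by (induction S rule: infinite_finite_induct) auto
qed

text \<open>
  Dividing a term by one of its variables.  The inclusion for the exponent of the cofactor allows a
  second variable to be split off.
\<close>
lemma single_eq_var_mult:
  assumes "i \<in> Poly_Mapping.keys m" "Poly_Mapping.keys m \<subseteq> {1..n}"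
  obtains r where "Poly_Mapping.single r (c::'k::field) \<in> carrier (poly_ring n)"
    "Poly_Mapping.keys m - {i} \<subseteq> Poly_Mapping.keys r"
    "Poly_Mapping.keys r \<subseteq> {1..n}"
    "Poly_Mapping.single m c = var i * Poly_Mapping.single r c"
proof -
  define r where "r = m - Poly_Mapping.single i 1"
  have "m = Poly_Mapping.single i 1 + r"
    using assms(1) by (intro poly_mapping_eqI)
      (auto simp: r_def lookup_add lookup_minus lookup_single when_def in_keys_iff)
  moreover have "Poly_Mapping.keys r \<subseteq> Poly_Mapping.keys m"
    by (auto simp: r_def in_keys_iff lookup_minus)
  moreover have "Poly_Mapping.keys m - {i} \<subseteq> Poly_Mapping.keys r"
    by (auto simp: r_def in_keys_iff lookup_minus lookup_single when_def split: if_splits)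
  ultimately show thesis using assms(2)
    by (intro that[of r]) (auto simp: mem_poly_ring_iff var_def mult_single)
qed

lemma from_axis_in_poly_ring:
  assumes "i \<in> {1..n}"
  shows "from_axis i (p :: ('k::field) poly) \<in> carrier (poly_ring n)"
  unfolding from_axis_def
proof (rule ideal_poly_ring_sum[OF ring.oneideal])
  show "ring (poly_ring n :: 'k mpoly ring)" using cring_poly_ring cring.axioms(1) by blast
qed (use assms in \<open>auto simp: mem_poly_ring_iff split: if_splits\<close>)

text \<open>
  Here and below the ring \<open>k[t]\<close> is a type rather than a record with a carrier, so its ideals are
  described by closure conditions.
\<close>
lemma ideal_axis_vimage:
  assumes "0 \<in> Q" "\<And>p q. p \<in> Q \<Longrightarrow> q \<in> Q \<Longrightarrow> p + q \<in> Q" "\<And>p q. q \<in> Q \<Longrightarrow> p * q \<in> Q"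
  shows "ideal {f \<in> carrier (poly_ring n). axis i f \<in> Q} (poly_ring n :: ('k::field) mpoly ring)"
proof -
  interpret cring "poly_ring n :: 'k mpoly ring" by (rule cring_poly_ring)
  show ?thesis
  proof (rule idealI)
    show "ring (poly_ring n :: 'k mpoly ring)" by (rule ring_axioms)
    show "subgroup {f \<in> carrier (poly_ring n). axis i f \<in> Q} (add_monoid (poly_ring n :: 'k mpoly ring))"
    proof (rule add.subgroupI)
      fix f :: "'k mpoly" assume f: "f \<in> {f \<in> carrier (poly_ring n). axis i f \<in> Q}"
      then have "\<ominus>\<^bsub>poly_ring n\<^esub> f = - f"
        using poly_ring_uminus_closed[of f n] by (intro minus_equality) auto
      moreover have "- axis i f \<in> Q" using assms(3)[of "axis i f" "-1"] f by simp
      ultimately show "\<ominus>\<^bsub>poly_ring n\<^esub> f \<in> {f \<in> carrier (poly_ring n). axis i f \<in> Q}"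
        using f poly_ring_uminus_closed[of f n] by simp
    next
      show "{f \<in> carrier (poly_ring n). axis i f \<in> Q} \<noteq> {}"
        using assms(1) zero_closed by (auto intro!: exI[of _ 0])
    qed (use assms(2) a_closed in auto)
  qed (use assms(3) m_closed in \<open>auto simp: mult.commute\<close>)
qed

lemma primeideal_axis_vimage:
  assumes "0 \<in> Q" "\<And>p q. p \<in> Q \<Longrightarrow> q \<in> Q \<Longrightarrow> p + q \<in> Q" "\<And>p q. q \<in> Q \<Longrightarrow> p * q \<in> Q"
    and "1 \<notin> Q" "\<And>p q. p * q \<in> Q \<Longrightarrow> p \<in> Q \<or> q \<in> Q"
  shows "primeideal {f \<in> carrier (poly_ring n). axis i f \<in> Q} (poly_ring n :: ('k::field) mpoly ring)"
proof (rule primeidealI[OF ideal_axis_vimage cring_poly_ring])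
  interpret cring "poly_ring n :: 'k mpoly ring" by (rule cring_poly_ring)
  have "1 \<in> carrier (poly_ring n :: 'k mpoly ring)" using one_closed by simp
  moreover have "1 \<notin> {f \<in> carrier (poly_ring n). axis i f \<in> Q}" using assms(4) by simp
  ultimately show "carrier (poly_ring n) \<noteq> {f \<in> carrier (poly_ring n). axis i f \<in> Q}" by metis
qed (use assms in auto)

section \<open>The edge ideal as the ideal of the union of the axes\<close>

lemma complete_graph_pair_iff: "{i, j} \<in> complete_graph n \<longleftrightarrow> i \<noteq> j \<and> i \<in> {1..n} \<and> j \<in> {1..n}"
  by (auto simp: complete_graph_def card_insert_if)

lemma edge_ideal_complete_is_ideal:
  "ideal (edge_ideal n (complete_graph n)) (poly_ring n :: ('k::field) mpoly ring)"
proof -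
  interpret cring "poly_ring n :: 'k mpoly ring" by (rule cring_poly_ring)
  show ?thesis unfolding edge_ideal_def
    by (rule genideal_ideal)
      (auto simp: complete_graph_pair_iff intro!: poly_ring_mult_closed var_in_poly_ring)
qed

text \<open>
  The scheme defined by all \<open>x\<^sub>i x\<^sub>j\<close> is the union of the coordinate axes, with reduced structure.  If
  \<open>f\<close> restricts to zero on every axis, no term of \<open>f\<close> is constant or a scalar multiple of a pure power, so each
  term involves two different variables and is a multiple of a generator.  For \<open>n = 0\<close> the constant
  \<open>1\<close> satisfies the right-hand side vacuously, although the ideal is zero.
\<close>
lemma edge_ideal_complete_mem_iff:
  fixes f :: "('k::field) mpoly"
  assumes "n \<ge> 1" and f: "f \<in> carrier (poly_ring n)"
  shows "f \<in> edge_ideal n (complete_graph n) \<longleftrightarrow> (\<forall>i\<in>{1..n}. axis i f = 0)"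
proof
  interpret R: cring "poly_ring n :: 'k mpoly ring" by (rule cring_poly_ring)
  show "\<forall>i\<in>{1..n}. axis i f = 0" if "f \<in> edge_ideal n (complete_graph n)"
  proof
    fix i assume "i \<in> {1..n}"
    have "edge_ideal n (complete_graph n) \<subseteq> {f \<in> carrier (poly_ring n). axis i f \<in> {0::'k poly}}"
      unfolding edge_ideal_def
      by (intro R.genideal_minimal ideal_axis_vimage)
        (auto simp: complete_graph_pair_iff axis_var intro!: poly_ring_mult_closed var_in_poly_ring)
    with that show "axis i f = 0" by auto
  qed
next
  interpret R: cring "poly_ring n :: 'k mpoly ring" by (rule cring_poly_ring)
  interpret I: ideal "edge_ideal n (complete_graph n)" "poly_ring n :: 'k mpoly ring"
    by (rule edge_ideal_complete_is_ideal)
  assume ax: "\<forall>i\<in>{1..n}. axis i f = 0"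
  have gen: "(var i * var j :: 'k mpoly) \<in> edge_ideal n (complete_graph n)" if "i \<in> {1..n}" "j \<in> {1..n}" "i \<noteq> j" for i j
  proof -
    have "{var i * var j | i j. {i, j} \<in> complete_graph n} \<subseteq> carrier (poly_ring n :: 'k mpoly ring)"
      by (auto simp: complete_graph_pair_iff intro!: poly_ring_mult_closed var_in_poly_ring)
    moreover have "var i * var j \<in> {var i * var j :: 'k mpoly | i j. {i, j} \<in> complete_graph n}"
      using that complete_graph_pair_iff[of i j n] by blast
    ultimately show ?thesis unfolding edge_ideal_def by (rule subsetD[OF R.genideal_self])
  qed
  have "Poly_Mapping.single m (Poly_Mapping.lookup f m) \<in> edge_ideal n (complete_graph n)"
    if m: "m \<in> Poly_Mapping.keys f" for m
  proof -
    have mn: "Poly_Mapping.keys m \<subseteq> {1..n}" using f m by (simp add: mem_poly_ring_iff)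
    \<comment> \<open>The coefficient of \<open>f\<close> at a pure power of \<open>x\<^sub>i\<close>, or at \<open>1\<close>, is one of its restriction to the axis.\<close>
    have off: "\<not> Poly_Mapping.keys m \<subseteq> {i}" if "i \<in> {1..n}" for i
      using m ax that coeff_axis[of i f]
      by (metis coeff_0 in_keys_iff keys_subset_singleton_iff)
    \<comment> \<open>Some axis is needed to rule out a constant term.\<close>
    have "1 \<in> {1..n}" using \<open>n \<ge> 1\<close> by simp
    then obtain i where i: "i \<in> Poly_Mapping.keys m" using off by blast
    then have "i \<in> {1..n}" using mn by blast
    then obtain j where j: "j \<in> Poly_Mapping.keys m" "j \<noteq> i" using off by blast
    obtain r where r: "Poly_Mapping.keys m - {i} \<subseteq> Poly_Mapping.keys r" "Poly_Mapping.keys r \<subseteq> {1..n}"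
      "Poly_Mapping.single m (Poly_Mapping.lookup f m) = var i * Poly_Mapping.single r (Poly_Mapping.lookup f m)"
      using single_eq_var_mult[OF i mn] by metis
    have "j \<in> Poly_Mapping.keys r" using j r(1) by blast
    then obtain q where q: "Poly_Mapping.single q (Poly_Mapping.lookup f m) \<in> carrier (poly_ring n)"
      "Poly_Mapping.single r (Poly_Mapping.lookup f m) = var j * Poly_Mapping.single q (Poly_Mapping.lookup f m)"
      using single_eq_var_mult[OF _ r(2)] by metis
    have "j \<in> {1..n}" using j mn by blast
    from I.I_r_closed[OF gen[OF \<open>i \<in> {1..n}\<close> this j(2)[symmetric]] q(1)] show ?thesis
      unfolding r(3) q(2) by (simp add: mult.assoc)
  qed
  then show "f \<in> edge_ideal n (complete_graph n)"
    by (subst sum_singles[symmetric]) (rule ideal_poly_ring_sum[OF edge_ideal_complete_is_ideal])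
qed

text \<open>
  Equations in the quotient ring are equations between restrictions in the domain \<open>k[t]\<close>, checked axis
  by axis.  Together with the homomorphism rules for \<^const>\<open>axis\<close> this replaces all further computation
  with cosets.
\<close>
lemma edge_ideal_complete_coset_eq_iff:
  fixes f g :: "('k::field) mpoly"
  assumes "n \<ge> 1" and f: "f \<in> carrier (poly_ring n)" and g: "g \<in> carrier (poly_ring n)"
  shows "edge_ideal n (complete_graph n) +>\<^bsub>poly_ring n\<^esub> f = edge_ideal n (complete_graph n) +>\<^bsub>poly_ring n\<^esub> g
     \<longleftrightarrow> (\<forall>i\<in>{1..n}. axis i f = axis i g)"
proof -
  interpret R: cring "poly_ring n :: 'k mpoly ring" by (rule cring_poly_ring)
  have "f - g \<in> carrier (poly_ring n)"
    using R.minus_closed[OF f g] by (simp add: poly_ring_a_minus f g)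
  then show ?thesis
    using R.quotient_eq_iff_same_a_r_cos[OF edge_ideal_complete_is_ideal f g]
    by (simp add: poly_ring_a_minus f g edge_ideal_complete_mem_iff[OF \<open>n \<ge> 1\<close>])
qed

section \<open>Dimension\<close>

lemma poly_ideal_generator:
  fixes Q :: "('k::field) poly set"
  assumes diff: "\<And>p q. p \<in> Q \<Longrightarrow> q \<in> Q \<Longrightarrow> p - q \<in> Q"
    and mult: "\<And>p q. q \<in> Q \<Longrightarrow> p * q \<in> Q"
    and "p \<in> Q" "p \<noteq> 0"
  obtains d where "d \<in> Q" "d \<noteq> 0" "\<And>q. q \<in> Q \<Longrightarrow> d dvd q"
proof -
  obtain d where d: "d \<in> Q" "d \<noteq> 0" and min: "\<And>q. q \<in> Q \<Longrightarrow> q \<noteq> 0 \<Longrightarrow> degree d \<le> degree q"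
    using arg_min_nat_lemma[of "\<lambda>q. q \<in> Q \<and> q \<noteq> 0" p degree] assms(3,4) by blast
  have "d dvd q" if "q \<in> Q" for q
  proof -
    have "q mod d = q - (q div d) * d" by (simp add: minus_div_mult_eq_mod)
    then have "q mod d \<in> Q" using diff mult d that by simp
    then have "q mod d = 0" using min degree_mod_less[of d q] d by force
    then show ?thesis by (simp add: dvd_eq_mod_eq_0)
  qed
  with d show thesis by (rule that)
qed

text \<open>
  Let \<open>a\<close> and \<open>b\<close> generate \<open>Q\<close> and \<open>Q'\<close>, and write \<open>a = b c\<close>.  Since \<open>Q'\<close> is larger, \<open>b\<close> is not in \<open>Q\<close>, so primeness
  puts \<open>c\<close> in \<open>Q\<close>; then \<open>c\<close> is a multiple of \<open>a\<close>, and cancelling \<open>a\<close> shows that \<open>b\<close> is a unit.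
\<close>
lemma poly_prime_ideal_maximal:
  fixes Q Q' :: "('k::field) poly set"
  assumes Q: "\<And>p q. p \<in> Q \<Longrightarrow> q \<in> Q \<Longrightarrow> p - q \<in> Q" "\<And>p q. q \<in> Q \<Longrightarrow> p * q \<in> Q"
      "\<And>p q. p * q \<in> Q \<Longrightarrow> p \<in> Q \<or> q \<in> Q"
    and Q': "\<And>p q. p \<in> Q' \<Longrightarrow> q \<in> Q' \<Longrightarrow> p - q \<in> Q'" "\<And>p q. q \<in> Q' \<Longrightarrow> p * q \<in> Q'"
    and p: "p \<in> Q" "p \<noteq> 0" and "Q \<subset> Q'"
  shows "1 \<in> Q'"
proof -
  obtain a where a: "a \<in> Q" "a \<noteq> 0" "\<And>q. q \<in> Q \<Longrightarrow> a dvd q"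
    using poly_ideal_generator[OF Q(1,2) p] by blast
  have "p \<in> Q'" using p \<open>Q \<subset> Q'\<close> by blast
  then obtain b where b: "b \<in> Q'" "\<And>q. q \<in> Q' \<Longrightarrow> b dvd q"
    using poly_ideal_generator[OF Q' _ p(2)] by metis
  obtain c where c: "a = b * c" using a(1) b(2) \<open>Q \<subset> Q'\<close> by (meson dvdE psubsetD)
  have "b \<notin> Q"
  proof
    assume "b \<in> Q"
    then have "Q' \<subseteq> Q" using b(2) Q(2) by (metis dvdE mult.commute subsetI)
    with \<open>Q \<subset> Q'\<close> show False by blast
  qed
  then have "c \<in> Q" using a(1) c Q(3) by blast
  then obtain e where "c = a * e" using a(3) by (meson dvdE)
  then have "a * 1 = a * (e * b)" using c by (simp add: ac_simps)
  then have "1 = e * b" using a(2) by (simp only: mult_cancel_left) simp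
  with Q'(2)[OF b(1), of e] show ?thesis by simp
qed

text \<open>
  Of any two variables one lies in \<open>P\<close>, so at most one variable \<open>x\<^sub>i\<close> is missing from \<open>P\<close>.  The kernel of
  restriction to the \<open>i\<close>-th axis is generated by the remaining variables.  Geometrically: an irreducible
  subset of the union of the axes lies on a single axis.
\<close>
lemma primeideal_contains_axis_kernel:
  fixes P :: "('k::field) mpoly set"
  assumes "n \<ge> 1" and P: "primeideal P (poly_ring n)" "edge_ideal n (complete_graph n) \<subseteq> P"
  obtains i where "i \<in> {1..n}" "\<And>f. f \<in> carrier (poly_ring n) \<Longrightarrow> axis i f = 0 \<Longrightarrow> f \<in> P"
proof -
  interpret R: cring "poly_ring n :: 'k mpoly ring" by (rule cring_poly_ring)
  interpret P: primeideal P "poly_ring n" by fact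
  have pair: "var i \<in> P \<or> var j \<in> P" if "i \<in> {1..n}" "j \<in> {1..n}" "i \<noteq> j" for i j
  proof -
    have "var i * var j \<in> edge_ideal n (complete_graph n)"
      using that edge_ideal_complete_mem_iff[OF \<open>n \<ge> 1\<close> poly_ring_mult_closed, of "var i" "var j"]
      by (auto simp: var_in_poly_ring axis_var)
    then show ?thesis
      using P(2) P.I_prime[of "var i" "var j"] that by (auto simp: var_in_poly_ring)
  qed
  have "\<exists>i\<in>{1..n}. \<forall>j\<in>{1..n}. j \<noteq> i \<longrightarrow> var j \<in> P"
  proof (cases "\<exists>i\<in>{1..n}. var i \<notin> P")
    case True
    then show ?thesis using pair by metis
  next
    case False
    then show ?thesis using \<open>n \<ge> 1\<close> by (intro bexI[of _ 1]) auto
  qed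
  then obtain i where i: "i \<in> {1..n}" "\<And>j. j \<in> {1..n} \<Longrightarrow> j \<noteq> i \<Longrightarrow> var j \<in> P" by blast
  have "f \<in> P" if f: "f \<in> carrier (poly_ring n)" "axis i f = 0" for f
  proof -
    have "Poly_Mapping.single m (Poly_Mapping.lookup f m) \<in> P" if m: "m \<in> Poly_Mapping.keys f" for m
    proof -
      have mn: "Poly_Mapping.keys m \<subseteq> {1..n}" using f m by (simp add: mem_poly_ring_iff)
      have "\<not> Poly_Mapping.keys m \<subseteq> {i}"
        using m f(2) coeff_axis[of i f] by (metis coeff_0 in_keys_iff keys_subset_singleton_iff)
      then obtain j where j: "j \<in> Poly_Mapping.keys m" "j \<noteq> i" by blast
      then have "var j \<in> P" using i(2) mn by blast
      moreover obtain r where "Poly_Mapping.single r (Poly_Mapping.lookup f m) \<in> carrier (poly_ring n)"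
        "Poly_Mapping.single m (Poly_Mapping.lookup f m) = var j * Poly_Mapping.single r (Poly_Mapping.lookup f m)"
        using single_eq_var_mult[OF j(1) mn] by metis
      ultimately show ?thesis using P.I_r_closed by fastforce
    qed
    then show ?thesis
      by (subst sum_singles[symmetric]) (rule ideal_poly_ring_sum[OF P.is_ideal])
  qed
  with i(1) show thesis by (rule that)
qed

text \<open>
  All members of the chain contain the kernel of restriction to one axis, hence correspond to prime
  ideals of \<open>k[t]\<close>.  There the second one is nonzero, thus maximal, and leaves no room for a third.
\<close>
lemma no_prime_chain_2:
  fixes P :: "nat \<Rightarrow> ('k::field) mpoly set"
  assumes "n \<ge> 1" and P: "prime_chain (poly_ring n) P r" "r \<ge> 2"
    and sub: "edge_ideal n (complete_graph n) \<subseteq> P 0"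
  shows False
proof -
  interpret R: cring "poly_ring n :: 'k mpoly ring" by (rule cring_poly_ring)
  have prime: "primeideal (P 0) (poly_ring n)" "primeideal (P 1) (poly_ring n)" "primeideal (P 2) (poly_ring n)"
    and chain: "P 0 \<subset> P 1" "P 1 \<subset> P 2"
    using P by (auto simp: prime_chain_def numeral_2_eq_2)
  interpret P1: primeideal "P 1" "poly_ring n" by (rule prime)
  interpret P2: primeideal "P 2" "poly_ring n" by (rule prime)
  obtain i where i: "i \<in> {1..n}" and ker: "\<And>f. f \<in> carrier (poly_ring n) \<Longrightarrow> axis i f = 0 \<Longrightarrow> f \<in> P 0"
    using primeideal_contains_axis_kernel[OF \<open>n \<ge> 1\<close> prime(1) sub] by blast
  define Q where "Q k = axis i ` P k" for k
  have lift: "f \<in> P k" if "axis i f \<in> Q k" "f \<in> carrier (poly_ring n)" "k \<in> {1, 2}" for f k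
  proof -
    have id: "ideal (P k) (poly_ring n)" using that(3) P1.is_ideal P2.is_ideal by auto
    from that(1) obtain g where g: "g \<in> P k" "axis i f = axis i g" unfolding Q_def by blast
    have gc: "g \<in> carrier (poly_ring n)" using g(1) id by (rule ideal.Icarr[rotated])
    have "f - g \<in> carrier (poly_ring n)"
      using R.minus_closed[OF that(2) gc] by (simp add: poly_ring_a_minus that(2) gc)
    then have "f - g \<in> P 0" using ker g(2) by simp
    then have "f - g \<in> P k" using chain that(3) by auto
    from additive_subgroup.a_closed[OF ideal.axioms(1)[OF id] this g(1)] show ?thesis by simp
  qed
  have closed: "p - q \<in> Q k" "s * q \<in> Q k" if pq: "p \<in> Q k" "q \<in> Q k" and k: "k \<in> {1, 2}" for p q s k
  proof -
    have id: "ideal (P k) (poly_ring n)" using k P1.is_ideal P2.is_ideal by auto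
    interpret K: ideal "P k" "poly_ring n" by (rule id)
    obtain f g where fg: "f \<in> P k" "g \<in> P k" "p = axis i f" "q = axis i g"
      using pq by (auto simp: Q_def)
    have c: "f \<in> carrier (poly_ring n)" "g \<in> carrier (poly_ring n)" using fg K.Icarr by auto
    have "f - g \<in> P k"
      using K.a_closed[OF fg(1) K.a_inv_closed[OF fg(2)]] poly_ring_a_minus[OF c] by (simp add: a_minus_def)
    then show "p - q \<in> Q k" unfolding Q_def fg by (rule rev_image_eqI) simp
    have "from_axis i s * g \<in> P k"
      using K.I_l_closed[OF fg(2) from_axis_in_poly_ring[OF i]] by simp
    then show "s * q \<in> Q k" unfolding Q_def fg by (rule rev_image_eqI) (simp add: axis_from_axis)
  qed
  obtain f where f: "f \<in> P 1" "f \<notin> P 0" using chain by blast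
  have "1 \<in> Q 2"
  proof (rule poly_prime_ideal_maximal[of "Q 1" "Q 2" "axis i f"])
    show "axis i f \<in> Q 1" using f by (simp add: Q_def)
    show "axis i f \<noteq> 0" using f ker P1.Icarr by blast
    show "Q 1 \<subset> Q 2"
    proof -
      obtain g where g: "g \<in> P 2" "g \<notin> P 1" using chain by blast
      then have "axis i g \<notin> Q 1" using lift[of g 1] P2.Icarr by auto
      with g chain show ?thesis by (auto simp: Q_def)
    qed
    show "p \<in> Q 1 \<or> q \<in> Q 1" if "p * q \<in> Q 1" for p q
    proof -
      let ?f = "from_axis i p" and ?g = "from_axis i q"
      note c = from_axis_in_poly_ring[OF i]
      have "?f * ?g \<in> P 1"
      proof (rule lift)
        show "axis i (?f * ?g) \<in> Q 1" using that by (simp add: axis_from_axis)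
        show "?f * ?g \<in> carrier (poly_ring n)" by (rule poly_ring_mult_closed[OF c c])
      qed simp
      then have "?f \<in> P 1 \<or> ?g \<in> P 1" using P1.I_prime[OF c c] by simp
      then show ?thesis unfolding Q_def by (metis axis_from_axis image_eqI)
    qed
  qed (use closed in auto)
  then have "1 \<in> P 2" using lift[of 1 2] R.one_closed by simp
  then show False using P2.one_imp_carrier P2.I_notcarr by simp
qed

lemma krull_dim_quot_edge_ideal_complete:
  assumes "n \<ge> 1"
  shows "krull_dim (poly_ring n Quot (edge_ideal n (complete_graph n) :: ('k::field) mpoly set)) = 1"
proof -
  interpret R: cring "poly_ring n :: 'k mpoly ring" by (rule cring_poly_ring)
  let ?I = "edge_ideal n (complete_graph n) :: 'k mpoly set"
  note iff = R.prime_chain_quot_iff[OF edge_ideal_complete_is_ideal]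
  have upper: "r \<le> 1" if Q: "\<exists>Q. prime_chain (poly_ring n Quot ?I) Q r" for r
  proof (rule ccontr)
    assume "\<not> r \<le> 1"
    then have "r \<ge> 2" by simp
    obtain P where "prime_chain (poly_ring n) P r" "\<forall>i\<le>r. ?I \<subseteq> P i"
      using Q unfolding iff by blast
    with no_prime_chain_2[OF assms this(1) \<open>r \<ge> 2\<close>] show False by blast
  qed
  have lower: "\<exists>Q. prime_chain (poly_ring n Quot ?I) Q 1"
    unfolding iff
  proof (intro exI conjI allI impI)
    \<comment> \<open>The chain consists of the ideals of the first axis and of the origin.\<close>
    let ?V = "\<lambda>Q. {f \<in> carrier (poly_ring n). axis 1 f \<in> Q}"
    let ?P = "\<lambda>k::nat. ?V (if k = 0 then {0::'k poly} else {p. coeff p 0 = 0})"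
    have "primeideal (?V {0}) (poly_ring n)"
      by (rule primeideal_axis_vimage) auto
    moreover have "primeideal (?V {p. coeff p 0 = 0}) (poly_ring n)"
      by (rule primeideal_axis_vimage) (auto simp: coeff_mult)
    moreover have "var 1 \<in> ?V {p. coeff p 0 = 0} - ?V {0}"
      using assms by (auto simp: axis_var var_in_poly_ring)
    ultimately show "prime_chain (poly_ring n) ?P 1"
      by (auto simp: prime_chain_def)
    show "?I \<subseteq> ?P k" for k
    proof
      fix f assume f: "f \<in> ?I"
      then have "f \<in> carrier (poly_ring n)"
        using ideal.Icarr[OF edge_ideal_complete_is_ideal] by blast
      moreover from this f have "axis 1 f = 0"
        using edge_ideal_complete_mem_iff[OF assms, of f] assms by auto
      ultimately show "f \<in> ?P k" by simp
    qed
  qed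
  show ?thesis unfolding krull_dim_def
  proof (rule antisym)
    show "Sup {enat r |r. \<exists>P. prime_chain (poly_ring n Quot ?I) P r} \<le> 1"
      by (auto intro!: Sup_least dest!: upper[OF exI] simp: one_enat_def simp del: One_nat_def)
    show "1 \<le> Sup {enat r |r. \<exists>P. prime_chain (poly_ring n Quot ?I) P r}"
      using lower by (auto intro!: Sup_upper simp: one_enat_def)
  qed
qed

section \<open>Depth\<close>

lemma irrelevant_ideal_const_coeff:
  assumes "f \<in> (irrelevant_ideal n :: ('k::field) mpoly set)"
  shows "f \<in> carrier (poly_ring n)" "coeff (axis i f) 0 = 0"
proof -
  interpret R: cring "poly_ring n :: 'k mpoly ring" by (rule cring_poly_ring)
  have "irrelevant_ideal n \<subseteq> {f \<in> carrier (poly_ring n). axis i f \<in> {p. coeff p 0 = (0::'k)}}"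
    unfolding irrelevant_ideal_def
    by (intro R.genideal_minimal ideal_axis_vimage) (auto simp: coeff_mult axis_var var_in_poly_ring)
  with assms show "f \<in> carrier (poly_ring n)" "coeff (axis i f) 0 = 0" by auto
qed

text \<open>
  If \<open>f\<close> is a nonzerodivisor of the quotient ring and \<open>f, g\<close> both vanish at the origin, some relation \<open>g h = f w\<close> has
  \<open>h\<close> outside \<open>(f)\<close>, so \<open>f, g\<close> is not a regular sequence.  If there are at least two axes, \<open>h\<close> and \<open>w\<close> are the
  components of \<open>f\<close> and \<open>g\<close> along the first one.  Were \<open>h = f s\<close>, then \<open>s\<close> would be \<open>1\<close> on the first axis and
  \<open>0\<close> on the second, which is impossible as the axes meet in the origin.  On a single axis this choice
  degenerates to \<open>h = f\<close>, and \<open>h = f / t\<close>, \<open>w = g / t\<close> serve instead.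
\<close>
lemma second_element_not_regular:
  fixes f g :: "('k::field) mpoly"
  assumes "n \<ge> 1" and fg: "f \<in> irrelevant_ideal n" "g \<in> irrelevant_ideal n"
    and reg1: "\<And>h. h \<in> carrier (poly_ring n) \<Longrightarrow> \<forall>i\<in>{1..n}. axis i (f * h) = 0 \<Longrightarrow> \<forall>i\<in>{1..n}. axis i h = 0"
  shows "\<exists>h\<in>carrier (poly_ring n). \<exists>w\<in>carrier (poly_ring n).
    (\<forall>i\<in>{1..n}. axis i (g * h) = axis i (f * w)) \<and>
    (\<forall>s\<in>carrier (poly_ring n). \<exists>i\<in>{1..n}. axis i h \<noteq> axis i (f * s))"
proof -
  have one: "1 \<in> {1..n}" using assms(1) by simp
  note c = from_axis_in_poly_ring[OF one]
  have f0: "coeff (axis i f) 0 = 0" and g0: "coeff (axis i g) 0 = 0" for i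
    using fg by (auto intro: irrelevant_ideal_const_coeff)
  \<comment> \<open>A nonzerodivisor cannot vanish on an axis: it would annihilate the variable of that axis.\<close>
  have nz: "axis i f \<noteq> 0" if "i \<in> {1..n}" for i
  proof
    assume "axis i f = 0"
    then have "\<forall>j\<in>{1..n}. axis j (f * var i) = 0" by (simp add: axis_var)
    then have "axis i (var i) = (0::'k poly)"
      using reg1[of "var i"] that by (auto simp: var_in_poly_ring)
    then show False by (simp add: axis_var)
  qed
  show ?thesis
  proof (cases "n = 1")
    case True
    obtain p q where pq: "axis 1 f = pCons 0 p" "axis 1 g = pCons 0 q"
      using f0[of 1] g0[of 1] by (metis coeff_pCons_0 pCons_cases)
    show ?thesis
    proof (rule bexI[of _ "from_axis 1 p"], rule bexI[of _ "from_axis 1 q"], intro conjI ballI)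
      fix s :: "'k mpoly"
      have "p \<noteq> pCons 0 p * axis 1 s"
      proof
        assume "p = pCons 0 p * axis 1 s"
        then have "p * 1 = p * pCons 0 (axis 1 s)" by simp
        moreover have "p \<noteq> 0" using nz[OF one] pq by auto
        ultimately have "1 = pCons 0 (axis 1 s)" by (simp only: mult_cancel_left) simp
        then have "coeff 1 0 = (0::'k)" by (metis coeff_pCons_0)
        then show False by simp
      qed
      then show "\<exists>i\<in>{1..n}. axis i (from_axis 1 p) \<noteq> axis i (f * s)"
        using one by (intro bexI[of _ 1]) (simp_all add: axis_from_axis pq del: One_nat_def)
    qed (use c True in \<open>auto simp: axis_from_axis pq mult.commute simp del: One_nat_def\<close>)
  next
    case False
    then have two: "2 \<in> {1..n}" using assms(1) by simp
    have ax: "axis i (from_axis 1 (axis 1 f)) = (if i = 1 then axis 1 f else 0)"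
      "axis i (from_axis 1 (axis 1 g)) = (if i = 1 then axis 1 g else 0)" for i
      using f0[of 1] g0[of 1] by (simp_all add: axis_from_axis axis_from_axis_other)
    show ?thesis
    proof (rule bexI[of _ "from_axis 1 (axis 1 f)"], rule bexI[of _ "from_axis 1 (axis 1 g)"],
        intro conjI ballI)
      fix s :: "'k mpoly"
      show "\<exists>i\<in>{1..n}. axis i (from_axis 1 (axis 1 f)) \<noteq> axis i (f * s)"
      proof (rule ccontr)
        assume "\<not> ?thesis"
        then have "axis 1 f * 1 = axis 1 f * axis 1 s" "0 = axis 2 f * axis 2 s"
          using one two ax[of 1] ax[of 2] by force+
        then have "axis 1 s = 1" "axis 2 s = 0"
          using nz[OF one] nz[OF two] by (simp_all only: mult_cancel_left) simp_all
        \<comment> \<open>The constant term of \<open>s\<close> can be read off on any axis.\<close>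
        then have "Poly_Mapping.lookup s 0 = 1" "Poly_Mapping.lookup s 0 = 0"
          using coeff_axis[of 1 s 0] coeff_axis[of 2 s 0] by simp_all
        then show False by simp
      qed
    qed (use c in \<open>auto simp: ax mult.commute simp del: One_nat_def\<close>)
  qed
qed

text \<open>
  The sum of all variables restricts to \<open>t\<close> on each axis, which makes it a nonzerodivisor, and it is not
  a unit as it vanishes at the origin.  Longer sequences are excluded by the preceding lemma.
\<close>
lemma depth_quot_edge_ideal_complete:
  assumes "n \<ge> 1"
  shows "depth (poly_ring n Quot (edge_ideal n (complete_graph n) :: ('k::field) mpoly set))
    ((+>\<^bsub>poly_ring n\<^esub>) (edge_ideal n (complete_graph n)) ` irrelevant_ideal n) = 1"
proof -
  let ?R = "poly_ring n :: 'k mpoly ring"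
  let ?I = "edge_ideal n (complete_graph n) :: 'k mpoly set"
  let ?A = "?R Quot ?I" and ?c = "(+>\<^bsub>poly_ring n\<^esub>) ?I"
  interpret R: cring ?R by (rule cring_poly_ring)
  interpret I: ideal ?I ?R by (rule edge_ideal_complete_is_ideal)
  interpret A: cring ?A by (rule I.quotient_is_cring[OF cring_poly_ring])
  have one: "1 \<in> {1..n}" using assms by simp
  have carrA: "carrier ?A = ?c ` carrier ?R" by (rule I.quot_carrier)
  have multA: "?c f \<otimes>\<^bsub>?A\<^esub> ?c g = ?c (f * g)" if "f \<in> carrier ?R" "g \<in> carrier ?R" for f g
    using I.quot_mult[OF that] by simp
  have zeroA: "\<zero>\<^bsub>?A\<^esub> = ?c 0" and oneA: "\<one>\<^bsub>?A\<^esub> = ?c 1"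
    using I.a_rcos_const[OF I.zero_closed] by (simp_all add: I.quot_zero I.quot_one)
  note eq = edge_ideal_complete_coset_eq_iff[OF assms]
  have c01: "0 \<in> carrier ?R" "1 \<in> carrier ?R" using R.zero_closed R.one_closed by simp_all
  have upper: "length as \<le> 1" if sub: "set as \<subseteq> ?c ` irrelevant_ideal n" and reg: "regular_sequence ?A as" for as
  proof (rule ccontr)
    assume "\<not> length as \<le> 1"
    then have "2 \<le> length as" by simp
    from A.regular_sequence_first_two[OF reg this] obtain a b where ab: "a \<in> set as" "b \<in> set as"
      and reg1: "\<forall>h\<in>carrier ?A. a \<otimes>\<^bsub>?A\<^esub> h = \<zero>\<^bsub>?A\<^esub> \<longrightarrow> h = \<zero>\<^bsub>?A\<^esub>"
      and reg2: "\<forall>h\<in>carrier ?A. \<forall>w\<in>carrier ?A. b \<otimes>\<^bsub>?A\<^esub> h = a \<otimes>\<^bsub>?A\<^esub> w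
             \<longrightarrow> (\<exists>s\<in>carrier ?A. h = a \<otimes>\<^bsub>?A\<^esub> s)"
      by (elim bexE conjE)
    obtain f g where fg: "f \<in> irrelevant_ideal n" "g \<in> irrelevant_ideal n" "a = ?c f" "b = ?c g"
      using sub ab by blast
    note fgc = fg(1,2)[THEN irrelevant_ideal_const_coeff(1)]
    have reg1': "\<forall>i\<in>{1..n}. axis i h = 0" if "h \<in> carrier ?R" "\<forall>i\<in>{1..n}. axis i (f * h) = 0" for h
      using reg1[rule_format, of "?c h"] that fgc
      by (simp add: carrA fg(3) multA zeroA eq poly_ring_mult_closed c01)
    obtain h w where hw: "h \<in> carrier ?R" "w \<in> carrier ?R"
      "\<forall>i\<in>{1..n}. axis i (g * h) = axis i (f * w)"
      and no: "\<forall>s\<in>carrier ?R. \<exists>i\<in>{1..n}. axis i h \<noteq> axis i (f * s)"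
      using second_element_not_regular[OF assms fg(1,2) reg1'] by blast
    have "?c g \<otimes>\<^bsub>?A\<^esub> ?c h = ?c f \<otimes>\<^bsub>?A\<^esub> ?c w"
      unfolding multA[OF fgc(2) hw(1)] multA[OF fgc(1) hw(2)]
      using hw fgc eq[OF poly_ring_mult_closed poly_ring_mult_closed] by blast
    then obtain s where s: "s \<in> carrier ?R" "?c h = ?c f \<otimes>\<^bsub>?A\<^esub> ?c s"
      using reg2[rule_format, of "?c h" "?c w"] hw fg by (auto simp: carrA)
    then have "\<forall>i\<in>{1..n}. axis i h = axis i (f * s)"
      using eq[OF hw(1) poly_ring_mult_closed[OF fgc(1) s(1)]] by (simp only: multA[OF fgc(1) s(1)])
    with no s(1) show False by blast
  qed
  define \<sigma> where "\<sigma> = (\<Sum>i\<in>{1..n}. var i :: 'k mpoly)"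
  have sub: "var ` {1..n} \<subseteq> carrier ?R" by (auto simp: var_in_poly_ring)
  have s_irr: "\<sigma> \<in> irrelevant_ideal n"
    unfolding \<sigma>_def irrelevant_ideal_def
    using R.genideal_self[OF sub] by (intro ideal_poly_ring_sum[OF R.genideal_ideal[OF sub]]) auto
  then have s_car: "\<sigma> \<in> carrier ?R" by (rule irrelevant_ideal_const_coeff)
  have ax: "axis i \<sigma> = monom 1 1" if "i \<in> {1..n}" for i
    using that by (simp add: \<sigma>_def axis_var)
  have reg: "regular_sequence ?A [?c \<sigma>]"
  proof (rule A.regular_sequence_singleton)
    show "?c \<sigma> \<in> carrier ?A" using s_car by (simp add: carrA)
    fix b assume "b \<in> carrier ?A"
    then obtain h where h: "h \<in> carrier ?R" "b = ?c h" by (auto simp: carrA)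
    note m = poly_ring_mult_closed[OF s_car h(1)]
    show "b = \<zero>\<^bsub>?A\<^esub>" if "?c \<sigma> \<otimes>\<^bsub>?A\<^esub> b = \<zero>\<^bsub>?A\<^esub>"
      using that ax unfolding h(2) multA[OF s_car h(1)] zeroA eq[OF m c01(1)] eq[OF h(1) c01(1)]
      by simp
    show "?c \<sigma> \<otimes>\<^bsub>?A\<^esub> b \<noteq> \<one>\<^bsub>?A\<^esub>"
    proof
      assume "?c \<sigma> \<otimes>\<^bsub>?A\<^esub> b = \<one>\<^bsub>?A\<^esub>"
      then have "monom 1 1 * axis 1 h = 1"
        using ax one unfolding h(2) multA[OF s_car h(1)] oneA eq[OF m c01(2)] by force
      then have "coeff (monom 1 1 * axis 1 h) 0 = (1::'k)" by simp
      then show False by (simp add: coeff_mult)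
    qed
  qed
  show ?thesis unfolding depth_def
  proof (rule antisym)
    show "Sup {enat (length as) |as. set as \<subseteq> ?c ` irrelevant_ideal n \<and> regular_sequence ?A as} \<le> 1"
      using upper by (auto intro!: Sup_least simp: one_enat_def)
    show "1 \<le> Sup {enat (length as) |as. set as \<subseteq> ?c ` irrelevant_ideal n \<and> regular_sequence ?A as}"
      using reg s_irr by (intro Sup_upper) (auto intro!: exI[of _ "[?c \<sigma>]"] simp: one_enat_def)
  qed
qed

theorem lemma3p12:
  fixes n :: nat
  assumes "n \<ge> 1"
  shows "cohen_macaulay_ideal n (edge_ideal n (complete_graph n) :: ('k::field) mpoly set)"
  by (simp add: cohen_macaulay_ideal_def edge_ideal_complete_is_ideal
      krull_dim_quot_edge_ideal_complete[OF assms] depth_quot_edge_ideal_complete[OF assms])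

end
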